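(* Let $r$ be a complex number and $n\ge1$ an integer. Then, as polynomials in $x$: (i) $d_n^{(r)}(x)=d_n^{(r+1)}(x)-d_{n-2}^{(r+1)}(x)$; (ii) $d_n^{(r+1)}(x)=\sum_{k=0}^{\lfloor n/2\rfloor}d_{n-2k}^{(r)}(x)$; (iii) $(n+1)^2d_{n+1}^{(r)}(x)^2-(n+2r+1)^2d_n^{(r)}(x)^2=4(x-r)(x+1+r)\big(d_n^{(r+1)}(x)^2-d_{n-1}^{(r+1)}(x)^2\big)$; (iv) $(2r+1)\sum_{k=0}^{n-1}(2k+2r+1)d_k^{(r)}(x)^2=n^2d_n^{(r)}(x)^2-4(x-r)(x+1+r)d_{n-1}^{(r+1)}(x)^2$.
   Context: For a complex number (or polynomial) $a$ and integer $k\ge0$, $\binom{a}{k}=a(a-1)\cdots(a-k+1)/k!$. For a parameter $r$ and an integer $n\ge 0$, $d_n^{(r)}(x)=\sum_{k=0}^n\binom{x+r+k}{k}\binom{x-r}{n-k}$, and by convention $d_{-1}^{(r)}(x)=0$. *)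

theory Defs
  imports Complex_Main "HOL-Computational_Algebra.Polynomial"
begin

text \<open>
  The library's \<open>gchoose\<close> is only available at field types after \<open>Complex_Main\<close>, so the
  binomial coefficient of a polynomial is defined here, by the same formula. The lemma
  \<open>poly_pbinom\<close> relates it to \<open>gchoose\<close>.
\<close>

definition pbinom :: "complex poly \<Rightarrow> nat \<Rightarrow> complex poly" where
  "pbinom p k = smult (1 / fact k) (\<Prod>i = 0..<k. p - of_nat i)"

lemma poly_pbinom: "poly (pbinom p k) x = poly p x gchoose k"
  by (simp add: pbinom_def gbinomial_prod_rev poly_prod)

text \<open>
  The index ranges over the integers so that the convention \<open>d r (-1) = 0\<close> can be expressed;
  the value \<open>0\<close> at the remaining negative indices is arbitrary. The polynomial
  \<open>[:a, 1:]\<close> is \<open>x + a\<close>.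
\<close>

definition d :: "complex \<Rightarrow> int \<Rightarrow> complex poly" where
  "d r n = (if n < 0 then 0
     else (\<Sum>k=0..nat n. pbinom [:r + of_nat k, 1:] k * pbinom [:- r, 1:] (nat n - k)))"

lemma poly_d:
  "poly (d r (int n)) x =
     (\<Sum>k=0..n. ((x + r + of_nat k) gchoose k) * ((x - r) gchoose (n - k)))"
  by (simp add: d_def poly_sum poly_pbinom add_ac)

end

theory Submission
  imports Defs "HOL-Computational_Algebra.Formal_Power_Series"
begin

text \<open>
  For fixed \<open>x\<close> the generating function of \<open>d\<^sub>n\<^sup>(\<^sup>r\<^sup>)(x)\<close> is
  \<open>D\<^sub>r(t) = (1 + t)\<^bsup>x - r\<^esup> (1 - t)\<^bsup>-x - r - 1\<^esup>\<close>. Hence \<open>D\<^sub>r = (1 - t\<^sup>2) D\<^sub>r\<^sub>+\<^sub>1\<close>, which is (i)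
  and telescopes to (ii), and \<open>D\<^sub>r' = (A + B t) D\<^sub>r\<^sub>+\<^sub>1\<close> with \<open>A = 2 x + 1\<close> and \<open>B = 2 r + 1\<close>.
  Writing \<open>d\<^sub>n\<close> and \<open>e\<^sub>n\<close> for the values at the parameters \<open>r\<close> and \<open>r + 1\<close>, the two relations give
  \<open>(n + 1) d\<^sub>n\<^sub>+\<^sub>1 = A e\<^sub>n + B e\<^sub>n\<^sub>-\<^sub>1\<close> and \<open>(n + 2 r + 1) d\<^sub>n = B e\<^sub>n + A e\<^sub>n\<^sub>-\<^sub>1\<close>.
  The difference of the squares is \<open>(A\<^sup>2 - B\<^sup>2) (e\<^sub>n\<^sup>2 - e\<^sub>n\<^sub>-\<^sub>1\<^sup>2)\<close>, which is (iii), and summing (iii)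
  gives (iv).
\<close>

text \<open>The expansion of \<open>(1 - t)\<^bsup>-a - 1\<^esup>\<close>.\<close>

definition fps_neg_binomial :: "complex \<Rightarrow> complex fps" where
  "fps_neg_binomial a = Abs_fps (\<lambda>k. (a + of_nat k) gchoose k)"

text \<open>Coefficientwise this is Pascal's rule.\<close>

lemma fps_neg_binomial_shift:
  "(1 - fps_X) * fps_neg_binomial (a + 1) = fps_neg_binomial a"
proof (rule fps_ext)
  fix n
  show "fps_nth ((1 - fps_X) * fps_neg_binomial (a + 1)) n = fps_nth (fps_neg_binomial a) n"
  proof (cases n)
    case (Suc m)
    have "(a + of_nat m + 1 + 1) gchoose Suc m
        = ((a + of_nat m + 1) gchoose m) + ((a + of_nat m + 1) gchoose Suc m)"
      by (rule gbinomial_Suc_Suc)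
    then show ?thesis
      using Suc by (simp add: fps_neg_binomial_def left_diff_distrib add_ac)
  qed (simp add: fps_neg_binomial_def)
qed

lemma fps_deriv_neg_binomial:
  "fps_deriv (fps_neg_binomial a) = fps_const (a + 1) * fps_neg_binomial (a + 1)"
proof (rule fps_ext)
  fix n
  \<comment> \<open>By the two absorption identities both sides equal
    \<open>a + 1 + of_nat n\<close> times \<open>(a + of_nat n) gchoose n\<close>.\<close>
  have "of_nat (Suc n) * ((a + 1 + of_nat n) gchoose Suc n)
      = (a + 1) * ((a + 1 + of_nat n) gchoose n)"
    using gbinomial_absorb_comp[of "a + 1 + of_nat n" n]
      gbinomial_absorption[of n "a + 1 + of_nat n"] by (simp add: add_ac)
  then show "fps_nth (fps_deriv (fps_neg_binomial a)) n
      = fps_nth (fps_const (a + 1) * fps_neg_binomial (a + 1)) n"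
    by (simp add: fps_neg_binomial_def add_ac)
qed

lemma fps_binomial_shift:
  "(1 + fps_X) * fps_binomial (a - 1) = fps_binomial (a :: complex)"
proof (rule fps_ext)
  fix n
  show "fps_nth ((1 + fps_X) * fps_binomial (a - 1)) n = fps_nth (fps_binomial a) n"
    using gbinomial_Suc_Suc[of "a - 1"] by (cases n) (simp_all add: distrib_right)
qed

lemma fps_deriv_binomial:
  "fps_deriv (fps_binomial a) = fps_const a * fps_binomial (a - 1 :: complex)"
proof (rule fps_ext)
  fix n
  show "fps_nth (fps_deriv (fps_binomial a)) n
      = fps_nth (fps_const a * fps_binomial (a - 1)) n"
    using gbinomial_absorption[of n a] by (simp add: add_ac)
qed

definition d_fps :: "complex \<Rightarrow> complex \<Rightarrow> complex fps" where
  "d_fps r x = fps_neg_binomial (x + r) * fps_binomial (x - r)"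

lemma poly_d_fps: "poly (d r n) x = (if n < 0 then 0 else fps_nth (d_fps r x) (nat n))"
proof (cases "n < 0")
  case False
  then obtain m where "n = int m"
    using nonneg_int_cases[of n] by auto
  then show ?thesis
    by (simp add: poly_d d_fps_def fps_mult_nth fps_neg_binomial_def)
qed (simp add: d_def)

lemma d_fps_shift: "d_fps r x = (1 - fps_X^2) * d_fps (r + 1) x"
proof -
  have "d_fps r x = ((1 - fps_X) * fps_neg_binomial (x + r + 1))
      * ((1 + fps_X) * fps_binomial (x - r - 1))"
    by (simp only: d_fps_def fps_neg_binomial_shift fps_binomial_shift)
  then show ?thesis
    by (simp add: d_fps_def algebra_simps power2_eq_square)
qed

lemma fps_deriv_d_fps:
  "fps_deriv (d_fps r x)
    = (fps_const (2 * x + 1) + fps_const (2 * r + 1) * fps_X) * d_fps (r + 1) x"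
proof -
  let ?P = "fps_binomial (x - r - 1)" and ?Q = "fps_neg_binomial (x + r + 1)"
  have "fps_deriv (d_fps r x)
      = fps_neg_binomial (x + r) * (fps_const (x - r) * ?P)
        + fps_const (x + r + 1) * ?Q * fps_binomial (x - r)"
    by (simp add: d_fps_def fps_deriv_binomial fps_deriv_neg_binomial)
  \<comment> \<open>The shift identities, read backwards, give both summands the factor
    \<open>?Q * ?P\<close>, which is \<open>d_fps (r + 1) x\<close>.\<close>
  also have "\<dots> = ((1 - fps_X) * ?Q) * (fps_const (x - r) * ?P)
        + fps_const (x + r + 1) * ?Q * ((1 + fps_X) * ?P)"
    by (simp only: fps_neg_binomial_shift fps_binomial_shift)
  also have "\<dots> = (fps_const (x - r) * (1 - fps_X) + fps_const (x + r + 1) * (1 + fps_X))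
      * (?Q * ?P)"
    by (simp add: algebra_simps)
  also have "fps_const (x - r) * (1 - fps_X) + fps_const (x + r + 1) * (1 + fps_X)
      = fps_const (2 * x + 1) + fps_const (2 * r + 1) * fps_X"
    by (rule fps_ext) (simp add: algebra_simps)
  finally show ?thesis
    by (simp add: d_fps_def algebra_simps)
qed

lemma d_param_shift: "d r n = d (r + 1) n - d (r + 1) (n - 2)"
proof -
  have "poly (d r n) x = poly (d (r + 1) n - d (r + 1) (n - 2)) x" for x
  proof (cases "n < 0")
    case False
    then show ?thesis
      by (auto simp: poly_d_fps d_fps_shift[of r] left_diff_distrib fps_X_power_mult_nth
          nat_diff_distrib)
  qed (simp add: poly_d_fps)
  then show ?thesis
    by (simp add: poly_eq_poly_eq_iff[symmetric] fun_eq_iff)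
qed

text \<open>Compare the coefficients of \<open>t^(n - 1)\<close> in \<open>fps_deriv_d_fps\<close>.
  For \<open>n \<le> 0\<close> both sides vanish; at \<open>n = 0\<close> this uses the value
  \<open>0\<close> of \<open>d\<close> at both -1 and -2.\<close>

lemma d_deriv_recurrence:
  "smult (of_int n) (d r n) = [:1, 2:] * d (r + 1) (n - 1) + smult (2 * r + 1) (d (r + 1) (n - 2))"
proof -
  have "poly (smult (of_int n) (d r n)) x
      = poly ([:1, 2:] * d (r + 1) (n - 1) + smult (2 * r + 1) (d (r + 1) (n - 2))) x" for x
  proof (cases "n \<le> 0")
    case False
    then obtain m where m: "n = int m + 1"
      using zero_less_imp_eq_int[of n] by (metis Suc_pred int_ops(4) not_le)
    have "of_nat (Suc m) * fps_nth (d_fps r x) (Suc m)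
        = (2 * x + 1) * fps_nth (d_fps (r + 1) x) m
          + (2 * r + 1) * (if m = 0 then 0 else fps_nth (d_fps (r + 1) x) (m - 1))"
      using arg_cong[OF fps_deriv_d_fps[of r x], of "\<lambda>f. fps_nth f m"]
      by (simp add: distrib_right mult.assoc del: of_nat_Suc)
    then show ?thesis
      by (auto simp: m poly_d_fps nat_add_distrib nat_diff_distrib algebra_simps)
  qed (auto simp: poly_d_fps)
  then show ?thesis
    by (simp add: poly_eq_poly_eq_iff[symmetric] fun_eq_iff)
qed

text \<open>Adding \<open>2 * r + 1\<close> times \<open>d_param_shift\<close> to
  \<open>d_deriv_recurrence\<close> cancels the terms of index \<open>n - 2\<close>.\<close>

lemma d_reflected_recurrence:
  "smult (of_int n + 2 * r + 1) (d r n)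
    = smult (2 * r + 1) (d (r + 1) n) + [:1, 2:] * d (r + 1) (n - 1)"
proof -
  have "smult (of_int n + 2 * r + 1) (d r n)
      = smult (of_int n) (d r n) + smult (2 * r + 1) (d r n)"
    by (simp add: smult_add_left add.assoc)
  also have "\<dots> = [:1, 2:] * d (r + 1) (n - 1) + smult (2 * r + 1) (d (r + 1) (n - 2))
      + smult (2 * r + 1) (d (r + 1) n - d (r + 1) (n - 2))"
    by (simp only: d_deriv_recurrence d_param_shift[of r n, symmetric])
  finally show ?thesis
    by (simp add: smult_diff_right)
qed

lemma d_square_difference:
  "smult ((of_int n + 1)^2) ((d r (n + 1))^2) - smult ((of_int n + 2 * r + 1)^2) ((d r n)^2)
    = smult 4 ([:- r, 1:] * [:1 + r, 1:] * ((d (r + 1) n)^2 - (d (r + 1) (n - 1))^2))"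
proof -
  let ?e = "d (r + 1) n" and ?f = "d (r + 1) (n - 1)"
  have *: "smult (of_int n + 1) (d r (n + 1)) = [:1, 2:] * ?e + smult (2 * r + 1) ?f"
    using d_deriv_recurrence[of "n + 1" r] by simp
  have "smult ((of_int n + 1)^2) ((d r (n + 1))^2) - smult ((of_int n + 2 * r + 1)^2) ((d r n)^2)
      = (smult (of_int n + 1) (d r (n + 1)))^2 - (smult (of_int n + 2 * r + 1) (d r n))^2"
    by (simp only: smult_power)
  also have "\<dots> = ([:1, 2:] * ?e + [:2 * r + 1:] * ?f)^2 - ([:2 * r + 1:] * ?e + [:1, 2:] * ?f)^2"
    by (simp only: * d_reflected_recurrence) simp
  \<comment> \<open>The two squares have the same cross term, which cancels.\<close>
  also have "\<dots> = ([:1, 2:]^2 - [:2 * r + 1:]^2) * (?e^2 - ?f^2)"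
    by algebra
  \<comment> \<open>The left side factors as
    \<open>(2 * x - 2 * r) * (2 * x + 2 * r + 2)\<close>.\<close>
  also have "[:1, 2:]^2 - [:2 * r + 1:]^2 = smult 4 ([:- r, 1:] * [:1 + r, 1:])"
    by (simp add: power2_eq_square algebra_simps)
  finally show ?thesis
    by (simp only: mult_smult_left)
qed

text \<open>Iterating \<open>d_param_shift\<close> lowers the index by two until it is negative,
  where \<open>d\<close> is \<open>0\<close>.\<close>

lemma d_param_sum: "d (r + 1) (int n) = (\<Sum>k=0..n div 2. d r (int n - 2 * int k))"
proof (induction n rule: less_induct)
  case (less n)
  show ?case
  proof (cases "n < 2")
    case True
    then have "n div 2 = 0"
      by simp
    then show ?thesis
      using d_param_shift[of r n] True by (simp add: d_def)
  next
    case False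
    then obtain m where m: "n = m + 2"
      by (metis add.commute le_Suc_ex not_less)
    have "d (r + 1) n = d r n + d (r + 1) m"
      using d_param_shift[of r n] m by simp
    also have "d (r + 1) m = (\<Sum>k=0..m div 2. d r (int m - 2 * int k))"
      using less m by simp
    also have "d r n + \<dots> = (\<Sum>k=0..n div 2. d r (int n - 2 * int k))"
      by (simp add: m sum.atLeast0_atMost_Suc_shift algebra_simps
          del: sum.cl_ivl_Suc)
    finally show ?thesis .
  qed
qed

lemma d_weighted_square_sum:
  "smult (2 * r + 1) (\<Sum>k=0..int n - 1. smult (2 * of_int k + 2 * r + 1) ((d r k)^2))
    = smult ((of_nat n)^2) ((d r n)^2)
      - smult 4 ([:- r, 1:] * [:1 + r, 1:] * (d (r + 1) (int n - 1))^2)"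
proof (induction n)
  case 0
  show ?case
    by (simp add: d_def)
next
  case (Suc n)
  let ?s = "\<lambda>k. smult (2 * of_int k + 2 * r + 1) ((d r k)^2)"
  let ?c = "[:- r, 1:] * [:1 + r, 1:]"
  have "{0..int (Suc n) - 1} = insert (int n) {0..int n - 1}"
    by auto
  then have "smult (2 * r + 1) (\<Sum>k=0..int (Suc n) - 1. ?s k)
      = smult (2 * r + 1) (?s (int n)) + smult (2 * r + 1) (\<Sum>k=0..int n - 1. ?s k)"
    by (simp add: smult_add_right)
  \<comment> \<open>Here \<open>(2 * r + 1) * (2 * n + 2 * r + 1) = (n + 2 * r + 1)^2 - n^2\<close>;
    the last square cancels against the induction hypothesis.\<close>
  also have "smult (2 * r + 1) (?s (int n))
      = smult ((of_int (int n) + 2 * r + 1)^2) ((d r n)^2) - smult ((of_nat n)^2) ((d r n)^2)"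
    by (simp add: smult_diff_left[symmetric] power2_eq_square algebra_simps)
  also have "smult ((of_int (int n) + 2 * r + 1)^2) ((d r n)^2)
      = smult ((of_int (int n) + 1)^2) ((d r (int n + 1))^2)
        - smult 4 (?c * ((d (r + 1) n)^2 - (d (r + 1) (int n - 1))^2))"
    by (simp only: d_square_difference[symmetric]) simp
  finally show ?case
    by (simp only: Suc.IH) (simp add: algebra_simps smult_diff_right)
qed

theorem theorem2p4:
  fixes r :: complex and n :: int
  assumes "n \<ge> 1"
  shows
    "(d r n = d (r + 1) n - d (r + 1) (n - 2)) \<and>
     (d (r + 1) n = (\<Sum>k=0..\<lfloor>of_int n / 2 :: real\<rfloor>. d r (n - 2 * k))) \<and>
     (smult ((of_int n + 1)^2) ((d r (n + 1))^2)
        - smult ((of_int n + 2 * r + 1)^2) ((d r n)^2)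
      = smult 4 ([:- r, 1:] * [:1 + r, 1:] * ((d (r + 1) n)^2 - (d (r + 1) (n - 1))^2))) \<and>
     (smult (2 * r + 1) (\<Sum>k=0..n - 1. smult (2 * of_int k + 2 * r + 1) ((d r k)^2))
      = smult ((of_int n)^2) ((d r n)^2)
        - smult 4 ([:- r, 1:] * [:1 + r, 1:] * (d (r + 1) (n - 1))^2))"
proof -
  obtain m where m: "n = int m"
    using assms nonneg_int_cases[of n] by auto
  have "\<lfloor>of_int n / 2 :: real\<rfloor> = int (m div 2)"
    using floor_divide_of_int_eq[of n 2, where ?'a = real] by (simp add: m zdiv_int)
  \<comment> \<open>The sum in the statement runs over integers, the one in
    \<open>d_param_sum\<close> over naturals.\<close>
  moreover have "{0..int (m div 2)} = int ` {0..m div 2}"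
    by (simp add: image_int_atLeastAtMost)
  ultimately have "(\<Sum>k=0..\<lfloor>of_int n / 2 :: real\<rfloor>. d r (n - 2 * k))
      = (\<Sum>k=0..m div 2. d r (int m - 2 * int k))"
    by (simp add: m sum.reindex)
  then show ?thesis
    using d_param_shift[of r n] d_param_sum[of r m] d_square_difference[of n r]
      d_weighted_square_sum[of r m]
    unfolding m of_int_of_nat_eq by (intro conjI) (assumption | simp only:)+
qed

end
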